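(* Let $S_n$ be the symmetric group on $\{1,\dots,n\}$ equipped with a metric $d$, and let $\pi_n$ be the uniform distribution on $S_n$. Assume that $f:S_n\to\mathbb R$ is locally Lipschitz with respect to $d$, i.e. $|f(\sigma)-f(\sigma\tau_{ij})|\le d(\sigma,\sigma\tau_{ij})$ for all $\sigma\in S_n$ and $i,j\in\{1,\dots,n\}$. Then for all $t\ge0$ $$\pi_n\big(|f-\mathbb E_{\pi_n}f|\ge t\big)\le2\exp\Big(-\frac{t^2}{2\,\mathrm{ObsDiam}(S_n,d)}\Big).$$ As a consequence, $$\mathrm{Var}_{\pi_n}(f)\le4\,\mathrm{ObsDiam}(S_n,d).$$
   Context: $\tau_{ij}$ denotes the transposition of $i$ and $j$ ($\tau_{ii}$ is the identity), and $\sigma\tau_{ij}$ is the product in $S_n$ (composition, $(\sigma\tau_{ij})(k)=\sigma(\tau_{ij}(k))$). The observable diameter of $(S_n,d)$ is defined as $$\mathrm{ObsDiam}(S_n,d)=\max_{\sigma\in S_n}\frac1n\sum_{i,j=1}^n d(\sigma,\sigma\tau_{ij})^2 .$$ *)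

theory Defs
  imports "HOL-Probability.Probability" "HOL-Combinatorics.Permutations"
begin

definition Sym :: "nat \<Rightarrow> (nat \<Rightarrow> nat) set" where
  "Sym n = {p. p permutes {1..n}}"

definition ObsDiam :: "nat \<Rightarrow> ((nat \<Rightarrow> nat) \<Rightarrow> (nat \<Rightarrow> nat) \<Rightarrow> real) \<Rightarrow> real" where
  "ObsDiam n d =
     (MAX \<sigma>\<in>Sym n. 1 / real n * (\<Sum>i=1..n. \<Sum>j=1..n. (d \<sigma> (\<sigma> \<circ> Transposition.transpose i j))\<^sup>2))"

definition locally_Lipschitz ::
  "nat \<Rightarrow> ((nat \<Rightarrow> nat) \<Rightarrow> (nat \<Rightarrow> nat) \<Rightarrow> real) \<Rightarrow> ((nat \<Rightarrow> nat) \<Rightarrow> real) \<Rightarrow> bool" where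
  "locally_Lipschitz n d f \<longleftrightarrow>
     (\<forall>\<sigma>\<in>Sym n. \<forall>i\<in>{1..n}. \<forall>j\<in>{1..n}.
        \<bar>f \<sigma> - f (\<sigma> \<circ> Transposition.transpose i j)\<bar> \<le> d \<sigma> (\<sigma> \<circ> Transposition.transpose i j))"

definition unif_Sym :: "nat \<Rightarrow> (nat \<Rightarrow> nat) pmf" where
  "unif_Sym n = pmf_of_set (Sym n)"

end

theory Submission
  imports Defs
begin

text \<open>The uniform measure on the permutations of an \<open>n\<close>-element set satisfies the modified
  logarithmic Sobolev inequality
  \<open>Ent g \<le> 1/(2n) * (\<Sum>i j. E ((g \<sigma> - g (\<sigma> \<tau>\<^sub>i\<^sub>j)) (ln (g \<sigma>) - ln (g (\<sigma> \<tau>\<^sub>i\<^sub>j)))))\<close>, by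
  induction on \<open>n\<close>: condition on the value \<open>\<sigma> i\<close> and average over \<open>i\<close>. For \<open>g = exp (l f)\<close> the
  right-hand side is at most \<open>l\<^sup>2 D / 2 * E g\<close> with \<open>D\<close> the observable diameter, so Herbst's
  argument bounds the Laplace transform of \<open>f - E f\<close> by \<open>exp (l\<^sup>2 D / 2)\<close>. The tail bound is
  Chernoff's, and the variance bound follows from \<open>2 + x\<^sup>2 / 2 \<le> exp x + exp (- x)\<close> at
  \<open>l = 1 / sqrt D\<close>.\<close>

section \<open>Averages, entropy and Jensen-type inequalities\<close>

text \<open>Normalised finite sums stand in for integrals; \<open>unif_Sym\<close> enters only in
  the final theorem.\<close>

definition avg :: "'a set \<Rightarrow> ('a \<Rightarrow> real) \<Rightarrow> real" where
  "avg S f = (\<Sum>x\<in>S. f x) / real (card S)"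

definition entropy_on :: "'a set \<Rightarrow> ('a \<Rightarrow> real) \<Rightarrow> real" where
  "entropy_on S g = avg S (\<lambda>x. g x * ln (g x)) - avg S g * ln (avg S g)"

text \<open>Integrand of the Dirichlet form of \<open>g\<close> against \<open>ln g\<close>:
  symmetric, zero for equal arguments and, for positive ones, homogeneous of degree 1.\<close>

definition ldiff :: "real \<Rightarrow> real \<Rightarrow> real" where
  "ldiff a b = (a - b) * (ln a - ln b)"

lemma avg_add: "avg S (\<lambda>x. f x + g x) = avg S f + avg S g"
  by (simp add: avg_def sum.distrib add_divide_distrib)

lemma avg_diff: "avg S (\<lambda>x. f x - g x) = avg S f - avg S g"
  by (simp add: avg_def sum_subtractf diff_divide_distrib)

lemma avg_cmult: "avg S (\<lambda>x. c * f x) = c * avg S f"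
  by (simp add: avg_def sum_distrib_left)

lemma avg_multc: "avg S (\<lambda>x. f x * c) = avg S f * c"
  by (simp add: avg_def sum_distrib_right)

lemma avg_const: "finite S \<Longrightarrow> S \<noteq> {} \<Longrightarrow> avg S (\<lambda>x. c) = c"
  by (simp add: avg_def)

lemma avg_mono: "(\<And>x. x \<in> S \<Longrightarrow> f x \<le> g x) \<Longrightarrow> avg S f \<le> avg S g"
  unfolding avg_def by (intro divide_right_mono sum_mono) auto

lemma avg_nonneg: "(\<And>x. x \<in> S \<Longrightarrow> 0 \<le> f x) \<Longrightarrow> 0 \<le> avg S f"
  unfolding avg_def by (intro divide_nonneg_nonneg sum_nonneg) auto

lemma avg_pos: "finite S \<Longrightarrow> S \<noteq> {} \<Longrightarrow> (\<And>x. x \<in> S \<Longrightarrow> 0 < f x) \<Longrightarrow> 0 < avg S f"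
  unfolding avg_def by (intro divide_pos_pos sum_pos) (auto simp: card_gt_0_iff)

lemma avg_cong: "(\<And>x. x \<in> S \<Longrightarrow> f x = g x) \<Longrightarrow> avg S f = avg S g"
  by (simp add: avg_def)

lemma avg_sum: "avg S (\<lambda>x. \<Sum>i\<in>I. f i x) = (\<Sum>i\<in>I. avg S (f i))"
  unfolding avg_def by (subst sum.swap) (simp add: sum_divide_distrib)

lemma avg_swap: "avg S (\<lambda>x. avg T (f x)) = avg T (\<lambda>y. avg S (\<lambda>x. f x y))"
  unfolding avg_def
  by (simp add: sum_divide_distrib [symmetric], subst sum.swap) (simp add: mult.commute)

text \<open>Jensen for the concave \<open>ln\<close>: compare with the tangent line at the
  mean.\<close>

lemma avg_ln_le_ln_avg:
  assumes "finite S" "S \<noteq> {}" "\<And>x. x \<in> S \<Longrightarrow> 0 < g x"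
  shows "avg S (\<lambda>x. ln (g x)) \<le> ln (avg S g)"
proof -
  let ?m = "avg S g"
  have m: "0 < ?m" using assms by (rule avg_pos)
  have "avg S (\<lambda>x. ln (g x)) \<le> avg S (\<lambda>x. (ln ?m - 1) + g x * (1 / ?m))"
  proof (rule avg_mono)
    fix x assume "x \<in> S"
    then have g: "0 < g x" using assms by auto
    then have "ln (g x / ?m) \<le> g x / ?m - 1"
      using m by (intro ln_le_minus_one) auto
    then show "ln (g x) \<le> (ln ?m - 1) + g x * (1 / ?m)"
      using g m by (simp add: ln_div)
  qed
  also have "\<dots> = ln ?m"
    using m assms(1,2) by (simp only: avg_add avg_multc) (simp add: avg_const)
  finally show ?thesis .
qed

text \<open>The modified log-Sobolev inequality of the complete graph: the double average is twice
  the covariance of \<open>g\<close> and \<open>ln g\<close>, and Jensen bounds the average of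
  \<open>ln g\<close>.\<close>

lemma entropy_on_le_ldiff:
  assumes "finite S" "S \<noteq> {}" "\<And>x. x \<in> S \<Longrightarrow> 0 < g x"
  shows "entropy_on S g \<le> 1 / 2 * avg S (\<lambda>x. avg S (\<lambda>y. ldiff (g x) (g y)))"
proof -
  let ?G = "avg S g" and ?L = "avg S (\<lambda>x. ln (g x))" and ?M = "avg S (\<lambda>x. g x * ln (g x))"
  have "ldiff (g x) (g y) = g x * ln (g x) - g x * ln (g y) - (ln (g x) * g y - g y * ln (g y))" for x y
    by (simp add: ldiff_def algebra_simps)
  then have "avg S (\<lambda>x. avg S (\<lambda>y. ldiff (g x) (g y))) = 2 * (?M - ?G * ?L)"
    using assms(1,2) by (simp add: avg_diff avg_cmult avg_const avg_multc)
  moreover have "?G * ?L \<le> ?G * ln ?G"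
    using avg_ln_le_ln_avg [of S g] avg_pos [of S g] assms by (intro mult_left_mono) auto
  ultimately show ?thesis by (simp add: entropy_on_def)
qed

text \<open>\<open>ldiff\<close> is jointly convex, as the sum of \<open>a * ln (a / b)\<close> and
  the same expression with \<open>a\<close> and \<open>b\<close> exchanged; the proof averages
  tangent planes taken at the two means.\<close>

lemma ldiff_avg_le:
  assumes "finite S" "S \<noteq> {}" "\<And>s. s \<in> S \<Longrightarrow> 0 < x s" "\<And>s. s \<in> S \<Longrightarrow> 0 < y s"
  shows "ldiff (avg S x) (avg S y) \<le> avg S (\<lambda>s. ldiff (x s) (y s))"
proof -
  let ?X = "avg S x" and ?Y = "avg S y"
  have X: "0 < ?X" and Y: "0 < ?Y" using assms by (auto intro: avg_pos)
  \<comment> \<open>The left side is the tangent plane of \<open>a * ln (a / b)\<close> at the point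
    \<open>A\<close>, \<open>B\<close>. It has no constant term because the function is homogeneous
    of degree 1.\<close>
  have tangent: "a * (ln A - ln B) + a - b * (A / B) \<le> a * (ln a - ln b)"
    if "0 < a" "0 < b" "0 < A" "0 < B" for a b A B :: real
  proof -
    have "ln (b * A / (a * B)) \<le> b * A / (a * B) - 1"
      using that by (intro ln_le_minus_one) auto
    then have "a * ln (b * A / (a * B)) \<le> a * (b * A / (a * B) - 1)"
      using that by (intro mult_left_mono) auto
    also have "\<dots> = b * (A / B) - a" using that by (simp add: field_simps)
    finally show ?thesis using that by (simp add: ln_div ln_mult algebra_simps)
  qed
  \<comment> \<open>Averaging replaces \<open>x s\<close> and \<open>y s\<close> by their means,
    where the terms without logarithms cancel.\<close>
  have "ldiff ?X ?Y =
      avg S (\<lambda>s. (x s * (ln ?X - ln ?Y) + x s - y s * (?X / ?Y)) +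
                 (y s * (ln ?Y - ln ?X) + y s - x s * (?Y / ?X)))"
    using X Y by (simp only: avg_add avg_diff avg_multc) (simp add: ldiff_def algebra_simps)
  also have "\<dots> \<le> avg S (\<lambda>s. ldiff (x s) (y s))"
  proof (rule avg_mono)
    fix s assume "s \<in> S"
    then have "0 < x s" "0 < y s" using assms by auto
    from tangent [OF this X Y] tangent [OF this(2,1) Y X]
    show "(x s * (ln ?X - ln ?Y) + x s - y s * (?X / ?Y)) +
          (y s * (ln ?Y - ln ?X) + y s - x s * (?Y / ?X)) \<le> ldiff (x s) (y s)"
      by (simp add: ldiff_def algebra_simps)
  qed
  finally show ?thesis .
qed

lemma ldiff_nonneg: "0 < a \<Longrightarrow> 0 < b \<Longrightarrow> 0 \<le> ldiff a b"
  unfolding ldiff_def by (cases "a \<le> b") (auto intro: mult_nonneg_nonneg mult_nonpos_nonpos)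

section \<open>A modified logarithmic Sobolev inequality for random transpositions\<close>

abbreviation perms :: "'a set \<Rightarrow> ('a \<Rightarrow> 'a) set" where
  "perms A \<equiv> {p. p permutes A}"

abbreviation \<tau> :: "'a \<Rightarrow> 'a \<Rightarrow> 'a \<Rightarrow> 'a" where
  "\<tau> \<equiv> Transposition.transpose"

lemma perms_not_empty: "perms A \<noteq> {}"
  using permutes_id by blast

text \<open>Each permutation of \<open>A\<close> is uniquely \<open>\<tau> i b \<circ> q\<close>
  with \<open>q\<close> fixing \<open>i\<close>, and \<open>b\<close> is then the image of
  \<open>i\<close>.\<close>

lemma avg_perms_split:
  assumes "finite A" "i \<in> A"
  shows "avg (perms A) F = avg A (\<lambda>b. avg (perms (A - {i})) (\<lambda>q. F (\<tau> i b \<circ> q)))"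
proof -
  have A: "insert i (A - {i}) = A" using assms by auto
  have "(\<Sum>p\<in>perms A. F p) = (\<Sum>b\<in>A. \<Sum>q\<in>perms (A - {i}). F (\<tau> i b \<circ> q))"
    using sum_over_permutations_insert [of "A - {i}" i F] assms A by simp
  moreover have "card (perms A) = card A * card (perms (A - {i}))"
  proof -
    have "card A = Suc (card (A - {i}))" using assms by (metis card.remove)
    then show ?thesis
      using card_permutations [OF refl assms(1)] card_permutations [of "A - {i}"] assms(1) by simp
  qed
  ultimately show ?thesis
    by (simp add: avg_def sum_divide_distrib mult.commute)
qed

text \<open>The product of \<open>\<tau> i b\<close>, \<open>\<tau> b c\<close> and
  \<open>\<tau> i c\<close> moves \<open>i\<close> to \<open>b\<close>, then \<open>c\<close>, then
  back to \<open>i\<close>. So it permutes \<open>A - {i}\<close>, and left translation by it turns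
  one average into the other.\<close>

lemma avg_perms_transpose_left:
  fixes A :: "'a set"
  assumes "finite A" "i \<in> A" "b \<in> A" "c \<in> A"
  shows "avg (perms (A - {i})) (\<lambda>q. F (\<tau> i c \<circ> q)) =
    avg (perms (A - {i})) (\<lambda>q. F (\<tau> b c \<circ> (\<tau> i b \<circ> q)))"
proof -
  let ?r = "\<tau> i c \<circ> (\<tau> b c \<circ> \<tau> i b)"
  have "?r permutes A"
    using assms by (intro permutes_compose permutes_swap_id)
  moreover have "?r i = i" by simp
  ultimately have r: "?r permutes (A - {i})"
    using permutes_superset [of ?r A "A - {i}"] by auto
  have "\<tau> i c \<circ> (?r \<circ> q) = \<tau> b c \<circ> (\<tau> i b \<circ> q)" for q :: "'a \<Rightarrow> 'a"
    by (simp add: fun_eq_iff)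
  then show ?thesis
    unfolding avg_def by (subst setum_permutations_compose_left [OF r]) simp
qed

text \<open>Contribution of one transposition to the Dirichlet form. It acts on the right, as in
  \<open>ObsDiam\<close>, and the terms with \<open>i = j\<close> vanish.\<close>

definition tform :: "'a set \<Rightarrow> (('a \<Rightarrow> 'a) \<Rightarrow> real) \<Rightarrow> 'a \<Rightarrow> 'a \<Rightarrow> real" where
  "tform A g i j = avg (perms A) (\<lambda>p. ldiff (g p) (g (p \<circ> \<tau> i j)))"

text \<open>Chain rule for the entropy, conditioning on the image \<open>b\<close> of \<open>i\<close>. The conditional
  means for \<open>b\<close> and \<open>c\<close> are coupled by \<open>p \<mapsto> \<tau> b c \<circ> p\<close>, which is also a
  right translation by \<open>\<tau> i (inv p c)\<close>.\<close>

lemma entropy_on_perms_step: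
  assumes "finite A" "i \<in> A" and g: "\<And>p. 0 < g p"
  shows "entropy_on (perms A) g \<le>
    avg A (\<lambda>b. entropy_on (perms (A - {i})) (\<lambda>q. g (\<tau> i b \<circ> q))) +
    1 / 2 * avg A (tform A g i)"
proof -
  let ?P = "perms (A - {i})"
  define h where "h b = avg ?P (\<lambda>q. g (\<tau> i b \<circ> q))" for b
  have fin: "finite ?P" "finite (perms A)" using assms by (auto intro: finite_permutations)
  have A: "A \<noteq> {}" using assms by auto
  have h: "0 < h b" for b
    unfolding h_def using fin perms_not_empty g by (intro avg_pos) auto
  \<comment> \<open>The average of \<open>h b * ln (h b)\<close> is subtracted in the conditional
    entropies and added back in \<open>entropy_on A h\<close>.\<close>
  have split: "entropy_on (perms A) g =
      avg A (\<lambda>b. entropy_on ?P (\<lambda>q. g (\<tau> i b \<circ> q))) + entropy_on A h"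
    unfolding entropy_on_def avg_perms_split [OF assms(1,2)] h_def avg_diff by simp
  have hc: "h c = avg ?P (\<lambda>q. g (\<tau> b c \<circ> (\<tau> i b \<circ> q)))" if "b \<in> A" "c \<in> A" for b c
    unfolding h_def using assms that by (intro avg_perms_transpose_left)
  have "avg A (\<lambda>b. avg A (\<lambda>c. ldiff (h b) (h c))) \<le>
     avg A (\<lambda>b. avg A (\<lambda>c. avg ?P (\<lambda>q. ldiff (g (\<tau> i b \<circ> q)) (g (\<tau> b c \<circ> (\<tau> i b \<circ> q))))))"
  proof (intro avg_mono)
    fix b c assume bc: "b \<in> A" "c \<in> A"
    show "ldiff (h b) (h c) \<le>
      avg ?P (\<lambda>q. ldiff (g (\<tau> i b \<circ> q)) (g (\<tau> b c \<circ> (\<tau> i b \<circ> q))))"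
      \<comment> \<open>Both means now run over the same \<open>q\<close>, so joint convexity
        applies.\<close>
      unfolding hc [OF bc] unfolding h_def
      by (rule ldiff_avg_le) (use fin perms_not_empty g in auto)
  qed
  also have "\<dots> = avg A (\<lambda>b. avg ?P (\<lambda>q. avg A (\<lambda>c.
      ldiff (g (\<tau> i b \<circ> q)) (g (\<tau> b c \<circ> (\<tau> i b \<circ> q))))))"
    by (subst avg_swap [of A ?P]) simp
  also have "\<dots> = avg A (\<lambda>b. avg ?P (\<lambda>q. avg A (\<lambda>j.
      ldiff (g (\<tau> i b \<circ> q)) (g ((\<tau> i b \<circ> q) \<circ> \<tau> i j)))))"
  proof (rule avg_cong, rule avg_cong)
    fix b q assume b: "b \<in> A" and q: "q \<in> ?P"
    define p where "p = \<tau> i b \<circ> q"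
    have q': "q permutes A" using q by (auto intro: permutes_subset)
    have p: "p permutes A"
      unfolding p_def using q' b assms by (intro permutes_compose permutes_swap_id)
    have pi: "p i = b"
      using q permutes_not_in [of q "A - {i}" i] by (simp add: p_def)
    \<comment> \<open>Conjugating \<open>\<tau> i j\<close> by \<open>p\<close> gives the
      transposition of \<open>p i = b\<close> and \<open>p j\<close>; as \<open>j\<close> runs
      through \<open>A\<close>, so does \<open>c = p j\<close>.\<close>
    have "\<tau> b (p j) \<circ> p = p \<circ> \<tau> i j" for j
    proof -
      have "bij p" using p by (rule permutes_bij)
      then show ?thesis
        using transpose_comp_eq [of p b "p j"] pi by (auto simp: bij_is_inj inv_f_eq)
    qed
    then have "avg A (\<lambda>j. ldiff (g p) (g (p \<circ> \<tau> i j))) =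
        avg A (\<lambda>j. ldiff (g p) (g (\<tau> b (p j) \<circ> p)))" by simp
    also have "\<dots> = avg A (\<lambda>c. ldiff (g p) (g (\<tau> b c \<circ> p)))"
      unfolding avg_def
      by (simp add: sum.reindex_bij_betw [OF permutes_imp_bij [OF p], of "\<lambda>c. ldiff (g p) (g (\<tau> b c \<circ> p))"])
    finally show "avg A (\<lambda>c. ldiff (g (\<tau> i b \<circ> q)) (g (\<tau> b c \<circ> (\<tau> i b \<circ> q)))) =
        avg A (\<lambda>j. ldiff (g (\<tau> i b \<circ> q)) (g ((\<tau> i b \<circ> q) \<circ> \<tau> i j)))"
      by (simp add: p_def)
  qed
  also have "\<dots> = avg (perms A) (\<lambda>p. avg A (\<lambda>j. ldiff (g p) (g (p \<circ> \<tau> i j))))"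
    by (rule avg_perms_split [OF assms(1,2), symmetric])
  also have "\<dots> = avg A (tform A g i)"
    unfolding tform_def by (subst avg_swap) simp
  finally show ?thesis
    using entropy_on_le_ldiff [OF assms(1) A, of h] h split by simp
qed

text \<open>A pair \<open>a \<noteq> c\<close> survives the removal of \<open>i\<close> for all but
  two choices of \<open>i\<close>. Subtracting row and column \<open>i\<close> removes
  \<open>w i i\<close> twice, harmless since it is zero.\<close>

lemma sum_remove_both:
  fixes w :: "'a \<Rightarrow> 'a \<Rightarrow> real"
  assumes "finite A" "\<And>a. w a a = 0"
  shows "(\<Sum>i\<in>A. \<Sum>a\<in>A - {i}. \<Sum>c\<in>A - {i}. w a c) = (real (card A) - 2) * (\<Sum>a\<in>A. \<Sum>c\<in>A. w a c)"
proof -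
  have "(\<Sum>a\<in>A - {i}. \<Sum>c\<in>A - {i}. w a c) =
      (\<Sum>a\<in>A. \<Sum>c\<in>A. w a c) - (\<Sum>c\<in>A. w i c) - (\<Sum>a\<in>A. w a i)" if "i \<in> A" for i
    using that assms by (simp add: sum_diff1 sum_subtractf)
  then have "(\<Sum>i\<in>A. \<Sum>a\<in>A - {i}. \<Sum>c\<in>A - {i}. w a c) =
      (\<Sum>i\<in>A. (\<Sum>a\<in>A. \<Sum>c\<in>A. w a c) - (\<Sum>c\<in>A. w i c) - (\<Sum>a\<in>A. w a i))"
    by (intro sum.cong) auto
  also have "\<dots> = real (card A) * (\<Sum>a\<in>A. \<Sum>c\<in>A. w a c) - (\<Sum>a\<in>A. \<Sum>c\<in>A. w a c) - (\<Sum>i\<in>A. \<Sum>a\<in>A. w a i)"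
    by (simp add: sum_subtractf)
  also have "(\<Sum>i\<in>A. \<Sum>a\<in>A. w a i) = (\<Sum>a\<in>A. \<Sum>c\<in>A. w a c)"
    by (rule sum.swap)
  finally show ?thesis by (simp add: algebra_simps)
qed

text \<open>A single \<open>i\<close> would be treated differently from the other points; summing
  the step over all \<open>i\<close> restores the symmetry and reproduces the constant.\<close>

theorem entropy_on_perms_le:
  assumes "finite A" "\<And>p. 0 < g p"
  shows "entropy_on (perms A) g \<le> 1 / (2 * real (card A)) * (\<Sum>i\<in>A. \<Sum>j\<in>A. tform A g i j)"
  using assms
proof (induction "card A" arbitrary: A g)
  case 0
  then show ?case by (simp add: entropy_on_def avg_def)
next
  case (Suc m A g)
  define n where "n = real (card A)"
  define W where "W = (\<Sum>i\<in>A. \<Sum>j\<in>A. tform A g i j)"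
  have n: "n = real m + 1" using Suc by (simp add: n_def flip: Suc.hyps(2))
  have W: "0 \<le> W"
    unfolding W_def tform_def using Suc.prems by (intro sum_nonneg avg_nonneg ldiff_nonneg)
  have "entropy_on (perms A) g \<le>
      1 / (2 * real m) * (\<Sum>a\<in>A - {i}. \<Sum>c\<in>A - {i}. tform A g a c) + 1 / (2 * n) * (\<Sum>j\<in>A. tform A g i j)"
    if i: "i \<in> A" for i
  proof -
    have m: "m = card (A - {i})" using Suc i by simp
    have "avg A (\<lambda>b. entropy_on (perms (A - {i})) (\<lambda>q. g (\<tau> i b \<circ> q))) \<le>
        avg A (\<lambda>b. 1 / (2 * real m) * (\<Sum>a\<in>A - {i}. \<Sum>c\<in>A - {i}.
          tform (A - {i}) (\<lambda>q. g (\<tau> i b \<circ> q)) a c))"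
      unfolding m using m Suc.prems by (intro avg_mono Suc.hyps(1)) auto
    \<comment> \<open>Right multiplication by \<open>\<tau> a c\<close> does not interfere with the
      left factor \<open>\<tau> i b\<close>, so averaging over \<open>b\<close> reassembles the form
      on \<open>A\<close>.\<close>
    also have "\<dots> = 1 / (2 * real m) * (\<Sum>a\<in>A - {i}. \<Sum>c\<in>A - {i}. tform A g a c)"
      unfolding avg_cmult avg_sum tform_def avg_perms_split [OF Suc.prems(1) i]
      by (simp add: o_assoc)
    finally show ?thesis
      using entropy_on_perms_step [OF Suc.prems(1) i, of g] Suc.prems(2)
      by (simp add: avg_def n_def)
  qed
  then have "(\<Sum>i\<in>A. entropy_on (perms A) g) \<le> (\<Sum>i\<in>A.
      1 / (2 * real m) * (\<Sum>a\<in>A - {i}. \<Sum>c\<in>A - {i}. tform A g a c) + 1 / (2 * n) * (\<Sum>j\<in>A. tform A g i j))"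
    by (rule sum_mono)
  also have "\<dots> = 1 / (2 * real m) * ((n - 2) * W) + 1 / (2 * n) * W"
    unfolding sum.distrib sum_distrib_left [symmetric] n_def W_def
    by (subst sum_remove_both [OF Suc.prems(1)]) (auto simp: tform_def ldiff_def avg_def)
  also have "\<dots> = (1 / (2 * real m) * (n - 2) + 1 / (2 * n)) * W" by (simp only: distrib_right mult.assoc)
  also have "\<dots> \<le> 1 / 2 * W"
  proof (rule mult_right_mono [OF _ W])
    \<comment> \<open>Since \<open>n - 2 = m - 1\<close>, the first term is
      \<open>1/2 - 1/(2m)\<close>, and the second is at most \<open>1/(2m)\<close>. For
      \<open>m = 0\<close> division by zero makes the first term 0, and equality holds.\<close>
    show "1 / (2 * real m) * (n - 2) + 1 / (2 * n) \<le> 1 / 2"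
    proof (cases "m = 0")
      case False
      then have "1 / (2 * n) \<le> 1 / (2 * real m)" unfolding n by (intro frac_le) auto
      moreover have "1 / (2 * real m) * (n - 2) = 1 / 2 - 1 / (2 * real m)"
        using False unfolding n by (simp add: field_simps)
      ultimately show ?thesis by simp
    qed (simp add: n)
  qed
  finally have "n * entropy_on (perms A) g \<le> 1 / 2 * W" by (simp add: n_def)
  then show ?case
    using n by (simp add: W_def [symmetric] n_def [symmetric] field_simps)
qed

section \<open>Herbst's argument\<close>

text \<open>The derivative of \<open>ln (Z l) / l\<close> is the entropy divided by
  \<open>l\<^sup>2 * Z l\<close>, hence at most \<open>D / 2\<close>. So \<open>H\<close> stays
  below its limit at 0, the mean of \<open>f\<close>.\<close>

lemma herbst:
  assumes "finite S" "S \<noteq> {}"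
    and ent: "\<And>l. 0 < l \<Longrightarrow> entropy_on S (\<lambda>x. exp (l * f x)) \<le> l\<^sup>2 * D / 2 * avg S (\<lambda>x. exp (l * f x))"
    and "0 < l"
  shows "avg S (\<lambda>x. exp (l * f x)) \<le> exp (l * avg S f + l\<^sup>2 * D / 2)"
proof -
  define Z where "Z l = avg S (\<lambda>x. exp (l * f x))" for l
  define Z' where "Z' l = avg S (\<lambda>x. f x * exp (l * f x))" for l
  define H where "H l = ln (Z l) / l - l * D / 2" for l
  have Z: "0 < Z l" for l unfolding Z_def using assms(1,2) by (intro avg_pos) auto
  have DZ: "(Z has_real_derivative Z' l) (at l)" for l
    unfolding Z_def [abs_def] Z'_def avg_def
    by (intro DERIV_cdivide DERIV_sum) (auto intro!: derivative_eq_intros)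
  have DlnZ: "((\<lambda>l. ln (Z l)) has_real_derivative Z' l / Z l) (at l)" for l
    using DERIV_chain2 [OF DERIV_ln_divide [OF Z] DZ] by simp
  have Z0: "Z 0 = 1" "Z' 0 = avg S f"
    using assms(1,2) by (simp_all add: Z_def Z'_def avg_const)
  have Hmono: "H l \<le> H e" if e: "0 < e" "e \<le> l" for e
  proof (rule DERIV_nonpos_imp_nonincreasing [OF e(2)])
    fix x assume "e \<le> x" "x \<le> l"
    then have x: "0 < x" using e by auto
    let ?y = "(Z' x / Z x * x - ln (Z x)) / (x * x) - D / 2"
    have "(H has_real_derivative ?y) (at x)"
      using DERIV_diff [OF DERIV_divide [OF DlnZ [of x] DERIV_ident]
          DERIV_cdivide [OF DERIV_cmult_right [OF DERIV_ident, where c = D], of 2]] x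
      by (simp add: H_def [abs_def])
    moreover have "?y \<le> 0"
    proof -
      have "avg S (\<lambda>t. exp (x * f t) * ln (exp (x * f t))) = avg S (\<lambda>t. x * (f t * exp (x * f t)))"
        by (rule avg_cong) simp
      then have "entropy_on S (\<lambda>t. exp (x * f t)) = x * Z' x - Z x * ln (Z x)"
        by (simp only: entropy_on_def Z_def Z'_def avg_cmult)
      then have "x * Z' x - Z x * ln (Z x) \<le> x\<^sup>2 * D / 2 * Z x"
        using ent [OF x] by (simp add: Z_def)
      then show ?thesis using x Z [of x] by (simp add: field_simps power2_eq_square)
    qed
    ultimately show "\<exists>y. (H has_real_derivative y) (at x) \<and> y \<le> 0" by blast
  qed
  \<comment> \<open>Because \<open>ln (Z 0) = 0\<close>, this is the difference quotient of
    \<open>ln Z\<close> at 0.\<close>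
  have "((\<lambda>e. ln (Z e) / e) \<longlongrightarrow> avg S f) (at 0)"
    using DlnZ [of 0] Z0 by (simp add: has_field_derivative_iff)
  then have "((\<lambda>e. ln (Z e) / e) \<longlongrightarrow> avg S f) (at_right 0)"
    by (rule filterlim_mono) (auto simp: at_le)
  then have "(H \<longlongrightarrow> avg S f - 0 * D / 2) (at_right 0)"
    unfolding H_def [abs_def] by (intro tendsto_intros) auto
  moreover have "eventually (\<lambda>e. H l \<le> H e) (at_right 0)"
    using eventually_at_right_real [OF \<open>0 < l\<close>] by eventually_elim (simp add: Hmono)
  ultimately have "H l \<le> avg S f"
    using tendsto_lowerbound [of H] by fastforce
  then have "ln (Z l) \<le> l * avg S f + l\<^sup>2 * D / 2"
    using \<open>0 < l\<close> by (simp add: H_def field_simps power2_eq_square)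
  then show ?thesis
    using Z [of l] unfolding Z_def [symmetric] by (metis exp_le_cancel_iff exp_ln)
qed

text \<open>The trapezoid rule overestimates the integral of the convex \<open>exp\<close> over
  \<open>[0, t]\<close>.\<close>

lemma exp_diff_le_trapezoid:
  fixes t :: real
  assumes "0 \<le> t"
  shows "exp t - 1 \<le> t * (exp t + 1) / 2"
proof -
  let ?F = "\<lambda>t::real. t * (exp t + 1) / 2 - exp t"
  have "?F 0 \<le> ?F t"
  proof (rule DERIV_nonneg_imp_nondecreasing [OF assms])
    fix x :: real
    have "(?F has_real_derivative (1 - exp x + x * exp x) / 2) (at x)"
      by (auto intro!: derivative_eq_intros simp: field_simps)
    moreover have "exp x * (1 - x) \<le> exp x * exp (- x)"
      using exp_ge_add_one_self [of "- x"] by (intro mult_left_mono) auto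
    then have "0 \<le> (1 - exp x + x * exp x) / 2"
      by (simp add: exp_minus field_simps)
    ultimately show "\<exists>y. (?F has_real_derivative y) (at x) \<and> 0 \<le> y" by blast
  qed
  then show ?thesis by simp
qed

text \<open>The logarithmic mean of \<open>exp x\<close> and \<open>exp y\<close> is at most their
  arithmetic mean.\<close>

lemma ldiff_exp_le: "ldiff (exp x) (exp y) \<le> (x - y)\<^sup>2 * (exp x + exp y) / 2"
proof -
  have *: "ldiff (exp x) (exp y) \<le> (x - y)\<^sup>2 * (exp x + exp y) / 2" if "y \<le> x" for x y :: real
  proof -
    have "exp y * (exp (x - y) - 1) \<le> exp y * ((x - y) * (exp (x - y) + 1) / 2)"
      using that by (intro mult_left_mono exp_diff_le_trapezoid) auto
    moreover have "exp x = exp y * exp (x - y)" by (simp flip: exp_add)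
    ultimately have "exp x - exp y \<le> (x - y) * (exp x + exp y) / 2"
      by (simp add: algebra_simps)
    then have "(exp x - exp y) * (x - y) \<le> (x - y) * (exp x + exp y) / 2 * (x - y)"
      using that by (intro mult_right_mono) auto
    then show ?thesis by (simp add: ldiff_def power2_eq_square mult_ac)
  qed
  have "ldiff (exp x) (exp y) = ldiff (exp y) (exp x)" by (simp add: ldiff_def algebra_simps)
  then show ?thesis
    using * [of y x] * [of x y] by (cases "y \<le> x") (auto simp: power2_commute add.commute)
qed

text \<open>The substitution of \<open>p \<circ> \<tau> i j\<close> for \<open>p\<close> preserves
  the average and the squared increment, so the two endpoint terms of \<open>ldiff_exp_le\<close>
  contribute equally.\<close>

lemma tform_exp_le:
  assumes "finite A" "i \<in> A" "j \<in> A"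
  shows "tform A (\<lambda>p. exp (f p)) i j \<le>
    avg (perms A) (\<lambda>p. (f p - f (p \<circ> \<tau> i j))\<^sup>2 * exp (f p))"
proof -
  let ?t = "\<tau> i j"
  let ?D = "\<lambda>p. (f p - f (p \<circ> ?t))\<^sup>2"
  have "?D (p \<circ> ?t) = ?D p" for p
    by (simp add: comp_assoc power2_commute)
  then have reverse: "avg (perms A) (\<lambda>p. ?D p * exp (f (p \<circ> ?t))) = avg (perms A) (\<lambda>p. ?D p * exp (f p))"
    unfolding avg_def
    by (subst (2) sum_permutations_compose_right [OF permutes_swap_id [OF assms(2,3)]]) simp
  have "tform A (\<lambda>p. exp (f p)) i j \<le> avg (perms A) (\<lambda>p. (?D p * exp (f p) + ?D p * exp (f (p \<circ> ?t))) * (1 / 2))"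
    unfolding tform_def
  proof (rule avg_mono)
    show "ldiff (exp (f p)) (exp (f (p \<circ> ?t))) \<le> (?D p * exp (f p) + ?D p * exp (f (p \<circ> ?t))) * (1 / 2)" for p
      using ldiff_exp_le [of "f p" "f (p \<circ> ?t)"] by (simp add: distrib_left)
  qed
  also have "\<dots> = (avg (perms A) (\<lambda>p. ?D p * exp (f p)) + avg (perms A) (\<lambda>p. ?D p * exp (f (p \<circ> ?t)))) * (1 / 2)"
    by (simp only: avg_multc avg_add)
  finally show ?thesis unfolding reverse by simp
qed

text \<open>The hypothesis on \<open>D\<close> is unchanged when \<open>f\<close> is replaced by
  \<open>- f\<close>, so this bound serves both tails.\<close>

lemma perms_exp_bound:
  assumes "finite A" "A \<noteq> {}"
    and D: "\<And>p. p permutes A \<Longrightarrow>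
      1 / real (card A) * (\<Sum>i\<in>A. \<Sum>j\<in>A. (f p - f (p \<circ> \<tau> i j))\<^sup>2) \<le> D"
    and "0 < l"
  shows "avg (perms A) (\<lambda>p. exp (l * f p)) \<le> exp (l * avg (perms A) f + l\<^sup>2 * D / 2)"
proof (rule herbst)
  show "finite (perms A)" using assms by (intro finite_permutations)
  show "perms A \<noteq> {}" by (rule perms_not_empty)
  fix l :: real assume "0 < l"
  let ?n = "real (card A)"
  let ?V = "\<lambda>p. 1 / ?n * (\<Sum>i\<in>A. \<Sum>j\<in>A. (f p - f (p \<circ> \<tau> i j))\<^sup>2)"
  have "entropy_on (perms A) (\<lambda>p. exp (l * f p)) \<le>
      1 / (2 * ?n) * (\<Sum>i\<in>A. \<Sum>j\<in>A. tform A (\<lambda>p. exp (l * f p)) i j)"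
    using assms by (intro entropy_on_perms_le) auto
  also have "\<dots> \<le> 1 / (2 * ?n) * (\<Sum>i\<in>A. \<Sum>j\<in>A.
      avg (perms A) (\<lambda>p. (l * f p - l * f (p \<circ> \<tau> i j))\<^sup>2 * exp (l * f p)))"
    using assms by (intro mult_left_mono sum_mono tform_exp_le) auto
  also have "\<dots> = avg (perms A) (\<lambda>p. l\<^sup>2 / 2 * (?V p * exp (l * f p)))"
    unfolding avg_sum [symmetric] avg_cmult [symmetric]
    by (rule avg_cong)
      (simp add: right_diff_distrib [symmetric] power_mult_distrib sum_distrib_left sum_distrib_right mult_ac)
  also have "\<dots> \<le> avg (perms A) (\<lambda>p. l\<^sup>2 / 2 * (D * exp (l * f p)))"
    using D by (intro avg_mono mult_left_mono mult_right_mono) auto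
  finally show "entropy_on (perms A) (\<lambda>p. exp (l * f p)) \<le> l\<^sup>2 * D / 2 * avg (perms A) (\<lambda>p. exp (l * f p))"
    by (simp only: avg_cmult) simp
qed (fact \<open>0 < l\<close>)

section \<open>Concentration and variance\<close>

lemma avg_abs_tail_le:
  assumes "finite S" "S \<noteq> {}" "0 \<le> D" "0 \<le> t"
    and exp_le: "\<And>l. 0 < l \<Longrightarrow> avg S (\<lambda>x. exp (l * h x)) \<le> exp (l\<^sup>2 * D / 2)"
      "\<And>l. 0 < l \<Longrightarrow> avg S (\<lambda>x. exp (- l * h x)) \<le> exp (l\<^sup>2 * D / 2)"
  shows "avg S (\<lambda>x. of_bool (t \<le> \<bar>h x\<bar>)) \<le> 2 * exp (- (t\<^sup>2 / (2 * D)))"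
proof (cases "D = 0 \<or> t = 0")
  \<comment> \<open>If \<open>D = 0\<close>, division by zero makes the exponent 0, as does
    \<open>t = 0\<close>; the bound is then the trivial 2.\<close>
  case True
  have "avg S (\<lambda>x. of_bool (t \<le> \<bar>h x\<bar>)) \<le> avg S (\<lambda>x. 1)"
    by (intro avg_mono) auto
  then show ?thesis using True assms(1,2) by (auto simp: avg_const)
next
  case False
  then have D: "0 < D" and t: "0 < t" using assms by auto
  \<comment> \<open>The minimiser of \<open>l\<^sup>2 * D / 2 - l * t\<close>.\<close>
  define l where "l = t / D"
  have l: "0 < l" using D t by (simp add: l_def)
  have "avg S (\<lambda>x. of_bool (t \<le> \<bar>h x\<bar>)) \<le>
      avg S (\<lambda>x. (exp (l * h x) + exp (- l * h x)) * exp (- (l * t)))"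
  proof (rule avg_mono)
    fix x
    show "of_bool (t \<le> \<bar>h x\<bar>) \<le> (exp (l * h x) + exp (- l * h x)) * exp (- (l * t))"
    proof (cases "t \<le> \<bar>h x\<bar>")
      case True
      then have "l * t \<le> l * h x \<or> l * t \<le> - l * h x"
        using l mult_le_cancel_left_pos [of l t "h x"] mult_le_cancel_left_pos [of l t "- h x"] by auto
      then have "exp (l * t) \<le> exp (l * h x) + exp (- l * h x)"
        by (smt (verit) exp_gt_zero exp_le_cancel_iff)
      then have "exp (l * t) * exp (- (l * t)) \<le> (exp (l * h x) + exp (- l * h x)) * exp (- (l * t))"
        by (intro mult_right_mono) auto
      then show ?thesis using True by (simp flip: exp_add)
    qed (simp add: add_nonneg_nonneg)
  qed
  also have "\<dots> \<le> (exp (l\<^sup>2 * D / 2) + exp (l\<^sup>2 * D / 2)) * exp (- (l * t))"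
    unfolding avg_multc avg_add using exp_le [OF l] by (intro mult_right_mono add_mono) auto
  also have "\<dots> = 2 * exp (l\<^sup>2 * D / 2 - l * t)"
    using exp_add [of "l\<^sup>2 * D / 2" "- (l * t)"] by simp
  also have "l\<^sup>2 * D / 2 - l * t = - (t\<^sup>2 / (2 * D))"
    using D by (simp add: l_def field_simps power2_eq_square)
  finally show ?thesis .
qed

text \<open>Both sides are even. For \<open>x \<ge> 0\<close>, add the quadratic Taylor bound for
  \<open>exp x\<close> and the linear one for \<open>exp (- x)\<close>.\<close>

lemma exp_add_exp_minus_ge: "2 + x\<^sup>2 / 2 \<le> exp x + exp (- x)" for x :: real
proof -
  have "2 + y\<^sup>2 / 2 \<le> exp y + exp (- y)" if "0 \<le> y" for y :: real
    using exp_lower_Taylor_quadratic [OF that] exp_ge_add_one_self [of "- y"] by linarith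
  from this [of x] this [of "- x"] show ?thesis by (cases "0 \<le> x") auto
qed

lemma avg_square_le:
  assumes "finite S" "S \<noteq> {}" "0 \<le> D"
    and exp_le: "\<And>l. 0 < l \<Longrightarrow> avg S (\<lambda>x. exp (l * h x)) \<le> exp (l\<^sup>2 * D / 2)"
      "\<And>l. 0 < l \<Longrightarrow> avg S (\<lambda>x. exp (- l * h x)) \<le> exp (l\<^sup>2 * D / 2)"
  shows "avg S (\<lambda>x. (h x)\<^sup>2) \<le> 4 * D"
proof -
  have *: "l\<^sup>2 * avg S (\<lambda>x. (h x)\<^sup>2) \<le> 4 * (exp (l\<^sup>2 * D / 2) - 1)" if l: "0 < l" for l
  proof -
    have "avg S (\<lambda>x. 2 + l\<^sup>2 / 2 * (h x)\<^sup>2) \<le> avg S (\<lambda>x. exp (l * h x) + exp (- l * h x))"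
      using exp_add_exp_minus_ge [of "l * h _"] by (intro avg_mono) (simp add: power_mult_distrib)
    also have "\<dots> \<le> exp (l\<^sup>2 * D / 2) + exp (l\<^sup>2 * D / 2)"
      unfolding avg_add using exp_le [OF l] by (intro add_mono)
    finally show ?thesis
      unfolding avg_add avg_cmult avg_const [OF assms(1,2)] by simp
  qed
  show ?thesis
  proof (cases "D = 0")
    \<comment> \<open>Here the right side of the bound is
      \<open>4 * (exp 0 - 1) = 0\<close>.\<close>
    case True
    then show ?thesis using * [of 1] by simp
  next
    case False
    then have D: "0 < D" using assms by simp
    \<comment> \<open>With \<open>l = 1 / sqrt D\<close> the exponent is \<open>1/2\<close>, and
      \<open>exp (1/2) - 1 \<le> 1\<close> leaves the factor 4.\<close>
    have "exp (1 / 2) \<le> (2 :: real)" using exp_bound_half [of "1 / 2 :: real"] by simp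
    then have "1 / D * avg S (\<lambda>x. (h x)\<^sup>2) \<le> 4"
      using * [of "1 / sqrt D"] D by (simp add: power_divide)
    then show ?thesis using D by (simp add: field_simps)
  qed
qed

theorem theorem1p7:
  fixes n :: nat
    and d :: "(nat \<Rightarrow> nat) \<Rightarrow> (nat \<Rightarrow> nat) \<Rightarrow> real"
    and f :: "(nat \<Rightarrow> nat) \<Rightarrow> real"
  assumes "n \<ge> 1"
    and "Metric_space (Sym n) d"
    and "locally_Lipschitz n d f"
  shows "(\<forall>t::real. t \<ge> 0 \<longrightarrow> measure_pmf.prob (unif_Sym n)
              {\<sigma>. \<bar>f \<sigma> - measure_pmf.expectation (unif_Sym n) f\<bar> \<ge> t}
            \<le> 2 * exp (- (t\<^sup>2 / (2 * ObsDiam n d))))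
       \<and> measure_pmf.variance (unif_Sym n) f \<le> 4 * ObsDiam n d"
proof -
  let ?A = "{1..n}"
  define D where "D = ObsDiam n d"
  define m where "m = avg (perms ?A) f"
  have Sym: "Sym n = perms ?A" by (simp add: Sym_def)
  have fin: "finite (perms ?A)" and ne: "perms ?A \<noteq> {}"
    using perms_not_empty by (auto intro: finite_permutations)
  have A: "finite ?A" "?A \<noteq> {}" using assms(1) by auto
  have V: "1 / real (card ?A) * (\<Sum>i\<in>?A. \<Sum>j\<in>?A. (f p - f (p \<circ> \<tau> i j))\<^sup>2) \<le> D"
    if p: "p permutes ?A" for p
  proof -
    have "(f p - f (p \<circ> \<tau> i j))\<^sup>2 \<le> (d p (p \<circ> \<tau> i j))\<^sup>2" if "i \<in> ?A" "j \<in> ?A" for i j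
    proof -
      have "\<bar>f p - f (p \<circ> \<tau> i j)\<bar> \<le> d p (p \<circ> \<tau> i j)"
        using assms(3) p that by (simp add: locally_Lipschitz_def Sym_def)
      then show ?thesis by (metis power2_abs power_mono abs_ge_zero)
    qed
    then have "1 / real (card ?A) * (\<Sum>i\<in>?A. \<Sum>j\<in>?A. (f p - f (p \<circ> \<tau> i j))\<^sup>2) \<le>
        1 / real n * (\<Sum>i\<in>?A. \<Sum>j\<in>?A. (d p (p \<circ> \<tau> i j))\<^sup>2)"
      by (auto intro!: mult_left_mono divide_right_mono sum_mono)
    also have "\<dots> \<le> D"
      unfolding D_def ObsDiam_def Sym using fin p by (intro Max_ge) auto
    finally show ?thesis .
  qed
  \<comment> \<open>\<open>V\<close> at the identity bounds \<open>D\<close> below by a multiple of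
    a sum of squares.\<close>
  have D: "0 \<le> D"
    by (rule order_trans [OF _ V [OF permutes_id]]) (auto intro!: divide_nonneg_nonneg sum_nonneg)
  have up: "avg (perms ?A) (\<lambda>p. exp (l * (f p - m))) \<le> exp (l\<^sup>2 * D / 2)" if "0 < l" for l
  proof -
    have "avg (perms ?A) (\<lambda>p. exp (l * f p) * exp (- (l * m))) \<le>
        exp (l * m + l\<^sup>2 * D / 2) * exp (- (l * m))"
      unfolding avg_multc m_def using perms_exp_bound [OF A V that] by (rule mult_right_mono) auto
    then show ?thesis by (simp add: exp_add [symmetric] right_diff_distrib)
  qed
  have down: "avg (perms ?A) (\<lambda>p. exp (- l * (f p - m))) \<le> exp (l\<^sup>2 * D / 2)" if "0 < l" for l
  proof -
    have "avg (perms ?A) (\<lambda>p. - f p) = - m"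
      by (simp add: m_def avg_def sum_negf)
    then have "avg (perms ?A) (\<lambda>p. exp (l * - f p)) \<le> exp (l * - m + l\<^sup>2 * D / 2)"
      using perms_exp_bound [OF A, of "\<lambda>p. - f p" D l] V that by (simp add: power2_commute)
    then have "avg (perms ?A) (\<lambda>p. exp (l * - f p) * exp (l * m)) \<le>
        exp (l * - m + l\<^sup>2 * D / 2) * exp (l * m)"
      unfolding avg_multc by (intro mult_right_mono) auto
    then show ?thesis by (simp add: exp_add [symmetric] right_diff_distrib algebra_simps)
  qed
  \<comment> \<open>The variance is itself an expectation, so this rewrites it as well.\<close>
  have expect: "measure_pmf.expectation (unif_Sym n) F = avg (perms ?A) F" for F :: "_ \<Rightarrow> real"
    unfolding unif_Sym_def Sym avg_def using fin ne by (intro integral_pmf_of_set)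
  have prob: "measure_pmf.prob (unif_Sym n) {p. P p} = avg (perms ?A) (\<lambda>p. of_bool (P p))" for P
    unfolding unif_Sym_def Sym avg_def using fin ne
    by (simp add: measure_pmf_of_set Int_def)
  show ?thesis
    unfolding prob expect m_def [symmetric] D_def [symmetric]
  proof (intro conjI allI impI)
    show "avg (perms ?A) (\<lambda>p. of_bool (t \<le> \<bar>f p - m\<bar>)) \<le> 2 * exp (- (t\<^sup>2 / (2 * D)))" if "0 \<le> t" for t
      by (rule avg_abs_tail_le [OF fin ne D that up down])
    show "avg (perms ?A) (\<lambda>p. (f p - m)\<^sup>2) \<le> 4 * D"
      by (rule avg_square_le [OF fin ne D up down])
  qed
qed

end
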